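(* Let $\mathcal{I}$ and $\mathcal{J}$ be finite interpretations, $\Delta'\subseteq\Delta^{\mathcal{I}}$ and $\Delta''\subseteq\Delta^{\mathcal{J}}$, and suppose $\mathit{Names}(\Delta',\mathcal{I})\neq\emptyset$ and $\mathit{Names}(\Delta'',\mathcal{J})\neq\emptyset$. Let $Z$ be the maximal $\mathcal{ALC}$ bisimulation between $\mathcal{I}$ and $\mathcal{J}$. Then $\mathit{Names}(\Delta',\mathcal{I})=\mathit{Names}(\Delta'',\mathcal{J})$ if and only if $Z$ is total (left-total on $\Delta^{\mathcal{I}}$ and right-total on $\Delta^{\mathcal{J}}$) and the restriction $Z\cap(\mathit{NamedInd}(\Delta',\mathcal{I})\times\mathit{NamedInd}(\Delta'',\mathcal{J}))$ is total (left-total on $\mathit{NamedInd}(\Delta',\mathcal{I})$ and right-total on $\mathit{NamedInd}(\Delta'',\mathcal{J})$).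
   Context: $\mathcal{ALC}$ concepts: $C ::= A \mid \neg C \mid (C\sqcap C)\mid \exists r.C$ with the standard semantics over interpretations $\mathcal{I}=(\Delta^{\mathcal{I}},\cdot^{\mathcal{I}})$. An $\mathcal{ALC}$ bisimulation is a relation $Z\subseteq\Delta^{\mathcal{I}}\times\Delta^{\mathcal{J}}$ satisfying the standard Atom, Forth and Back conditions; the maximal one is the union of all of them. For $\Delta'\subseteq\Delta^{\mathcal{I}}$: $\mathit{Names}(\Delta',\mathcal{I})$ is the set of all $\mathcal{ALC}$ concepts $C$ with $C^{\mathcal{I}}=\{d\}$ for some $d\in\Delta'$; $\mathit{NamedInd}(\Delta',\mathcal{I})$ is the set of all $d\in\Delta'$ such that $d\in C^{\mathcal{I}}$ for some $C\in\mathit{Names}(\Delta',\mathcal{I})$. *)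

theory Defs
  imports Main
begin

text \<open>The type variables \<open>'c\<close> and \<open>'r\<close> are the sets of concept names and role names.\<close>

datatype ('c, 'r) concept =
    Name 'c
  | Neg "('c, 'r) concept"
  | And "('c, 'r) concept" "('c, 'r) concept"
  | Ex 'r "('c, 'r) concept"

record ('d, 'c, 'r) interp =
  domain :: "'d set"
  cname :: "'c \<Rightarrow> 'd set"
  rname :: "'r \<Rightarrow> ('d \<times> 'd) set"

definition interpretation_alc :: "('d, 'c, 'r) interp \<Rightarrow> bool" where
  "interpretation_alc I \<longleftrightarrow>
     domain I \<noteq> {} \<and> (\<forall>A. cname I A \<subseteq> domain I) \<and> (\<forall>r. rname I r \<subseteq> domain I \<times> domain I)"

definition finite_interpretation :: "('d, 'c, 'r) interp \<Rightarrow> bool" where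
  "finite_interpretation I \<longleftrightarrow> interpretation_alc I \<and> finite (domain I)"

primrec ext :: "('d, 'c, 'r) interp \<Rightarrow> ('c, 'r) concept \<Rightarrow> 'd set" where
  "ext I (Name A) = cname I A"
| "ext I (Neg C) = domain I - ext I C"
| "ext I (And C D) = ext I C \<inter> ext I D"
| "ext I (Ex r C) = {d \<in> domain I. \<exists>e. (d, e) \<in> rname I r \<and> e \<in> ext I C}"

definition bisimulation ::
    "('d, 'c, 'r) interp \<Rightarrow> ('e, 'c, 'r) interp \<Rightarrow> ('d \<times> 'e) set \<Rightarrow> bool" where
  "bisimulation I J Z \<longleftrightarrow>
     Z \<subseteq> domain I \<times> domain J \<and>
     (\<forall>d e A. (d, e) \<in> Z \<longrightarrow> (d \<in> cname I A \<longleftrightarrow> e \<in> cname J A)) \<and>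
     (\<forall>d e r d'. (d, e) \<in> Z \<and> (d, d') \<in> rname I r \<longrightarrow>
        (\<exists>e'. (e, e') \<in> rname J r \<and> (d', e') \<in> Z)) \<and>
     (\<forall>d e r e'. (d, e) \<in> Z \<and> (e, e') \<in> rname J r \<longrightarrow>
        (\<exists>d'. (d, d') \<in> rname I r \<and> (d', e') \<in> Z))"

definition max_bisimulation ::
    "('d, 'c, 'r) interp \<Rightarrow> ('e, 'c, 'r) interp \<Rightarrow> ('d \<times> 'e) set" where
  "max_bisimulation I J = \<Union> {Z. bisimulation I J Z}"

definition Names :: "'d set \<Rightarrow> ('d, 'c, 'r) interp \<Rightarrow> ('c, 'r) concept set" where
  "Names D I = {C. \<exists>d\<in>D. ext I C = {d}}"

definition NamedInd :: "'d set \<Rightarrow> ('d, 'c, 'r) interp \<Rightarrow> 'd set" where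
  "NamedInd D I = {d \<in> D. \<exists>C\<in>Names D I. d \<in> ext I C}"

definition left_total_on :: "'d set \<Rightarrow> ('d \<times> 'e) set \<Rightarrow> bool" where
  "left_total_on A R \<longleftrightarrow> (\<forall>a\<in>A. \<exists>b. (a, b) \<in> R)"

definition right_total_on :: "'e set \<Rightarrow> ('d \<times> 'e) set \<Rightarrow> bool" where
  "right_total_on B R \<longleftrightarrow> (\<forall>b\<in>B. \<exists>a. (a, b) \<in> R)"

end

theory Submission
  imports Defs
begin

text \<open>
  On finite interpretations the maximal bisimulation is concept equivalence (Hennessy--Milner),
  so an element with no partner in the other interpretation is separated from all of its elements
  by a single concept. Given equal names, let \<open>N\<close> be a common name and let \<open>C\<close> hold
  somewhere in \<open>I\<close> but nowhere in \<open>J\<close>. Then \<open>N \<squnion> C\<close> and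
  \<open>N \<sqinter> \<not>C\<close> have the same extension as \<open>N\<close> in \<open>J\<close>, hence are names in
  \<open>I\<close> too, which is impossible. Conversely, if a name \<open>C\<close> of \<open>d\<close> held at two
  elements of \<open>J\<close>, both would be bisimilar to \<open>d\<close>, contradicting that one of them is
  named.
\<close>

text \<open>The domains are part of the definition because elements outside the domain of an
  interpretation lie in no extension and would all count as equivalent.\<close>

definition concept_equiv :: "('d, 'c, 'r) interp \<Rightarrow> ('e, 'c, 'r) interp \<Rightarrow> ('d \<times> 'e) set" where
  "concept_equiv I J =
     {(d, e). d \<in> domain I \<and> e \<in> domain J \<and> (\<forall>C. d \<in> ext I C \<longleftrightarrow> e \<in> ext J C)}"

lemma concept_equiv_commute: "(d, e) \<in> concept_equiv I J \<longleftrightarrow> (e, d) \<in> concept_equiv J I"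
  by (auto simp: concept_equiv_def)

lemma ext_subset_domain:
  assumes "interpretation_alc I"
  shows "ext I C \<subseteq> domain I"
  using assms by (induction C) (auto simp: interpretation_alc_def)

lemma bisimulation_ext_iff:
  assumes "bisimulation I J Z" and "(d, e) \<in> Z"
  shows "d \<in> ext I C \<longleftrightarrow> e \<in> ext J C"
  using assms(2)
proof (induction C arbitrary: d e)
  case (Name A)
  then show ?case using assms(1) by (auto simp: bisimulation_def)
next
  case (Neg C)
  then show ?case using assms(1) by (auto simp: bisimulation_def)
next
  case (And C D)
  then show ?case by auto
next
  case (Ex r C)
  have dom: "d \<in> domain I" "e \<in> domain J"
    using assms(1) Ex.prems by (auto simp: bisimulation_def)
  have forth: "\<exists>e'. (e, e') \<in> rname J r \<and> (d', e') \<in> Z" if "(d, d') \<in> rname I r" for d'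
    using assms(1) Ex.prems that unfolding bisimulation_def by blast
  have backward: "\<exists>d'. (d, d') \<in> rname I r \<and> (d', e') \<in> Z" if "(e, e') \<in> rname J r" for e'
    using assms(1) Ex.prems that unfolding bisimulation_def by blast
  show ?case
    unfolding ext.simps using dom forth backward Ex.IH by blast
qed

text \<open>Each element of \<open>S\<close> disagrees with \<open>d\<close> on some concept;
  oriented so as to hold at \<open>d\<close>, these finitely many concepts are conjoined.\<close>

lemma separating_concept:
  assumes "finite S" and "d \<in> domain I" and "S \<subseteq> domain J"
    and "\<And>e. e \<in> S \<Longrightarrow> (d, e) \<notin> concept_equiv I J"
  shows "\<exists>C. d \<in> ext I C \<and> S \<inter> ext J C = {}"
  using assms(1,3,4)
proof (induction S rule: finite_induct)
  case empty
  \<comment> \<open>The syntax has no top concept; this tautology stands for the empty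
    conjunction.\<close>
  have "d \<in> ext I (Neg (And C (Neg C)))" for C
    using assms(2) by simp
  then show ?case by blast
next
  case (insert e S)
  then obtain C where C: "d \<in> ext I C" "S \<inter> ext J C = {}"
    by auto
  from insert.prems obtain F where F: "d \<in> ext I F \<longleftrightarrow> e \<notin> ext J F"
    using assms(2) by (auto simp: concept_equiv_def)
  define G where "G = (if d \<in> ext I F then F else Neg F)"
  have "d \<in> ext I G" "e \<notin> ext J G"
    using F assms(2) by (auto simp: G_def)
  then have "d \<in> ext I (And G C)" "insert e S \<inter> ext J (And G C) = {}"
    using C by auto
  then show ?case by blast
qed

text \<open>Otherwise one concept \<open>C\<close> separates \<open>d'\<close> from all
  \<open>r\<close>-successors of \<open>e\<close>, finitely many since \<open>J\<close> is finite,
  and \<open>Ex r C\<close> then tells \<open>d\<close> from \<open>e\<close>.\<close>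

lemma concept_equiv_forth:
  assumes "interpretation_alc I" and "finite_interpretation J"
    and "(d, e) \<in> concept_equiv I J" and "(d, d') \<in> rname I r"
  shows "\<exists>e'. (e, e') \<in> rname J r \<and> (d', e') \<in> concept_equiv I J"
proof (rule ccontr)
  assume contra: "\<not> ?thesis"
  define S where "S = {e'. (e, e') \<in> rname J r}"
  have "S \<subseteq> domain J"
    using assms(2) by (auto simp: S_def finite_interpretation_def interpretation_alc_def)
  moreover from this have "finite S"
    using assms(2) by (auto simp: finite_interpretation_def intro: finite_subset)
  moreover have "d' \<in> domain I"
    using assms(1,4) by (auto simp: interpretation_alc_def)
  moreover have "(d', e') \<notin> concept_equiv I J" if "e' \<in> S" for e'
    using contra that by (auto simp: S_def)
  ultimately obtain C where C: "d' \<in> ext I C" "S \<inter> ext J C = {}"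
    using separating_concept by metis
  have "d \<in> ext I (Ex r C)" "e \<notin> ext J (Ex r C)"
    using C assms(3,4) by (auto simp: S_def concept_equiv_def)
  then show False
    using assms(3) unfolding concept_equiv_def by blast
qed

lemma bisimulation_concept_equiv:
  assumes "finite_interpretation I" and "finite_interpretation J"
  shows "bisimulation I J (concept_equiv I J)"
proof -
  have ints: "interpretation_alc I" "interpretation_alc J"
    using assms by (auto simp: finite_interpretation_def)
  have sub: "concept_equiv I J \<subseteq> domain I \<times> domain J"
    by (auto simp: concept_equiv_def)
  have atom: "d \<in> cname I A \<longleftrightarrow> e \<in> cname J A" if "(d, e) \<in> concept_equiv I J" for d e A
    using that by (simp add: concept_equiv_def flip: ext.simps(1))
  \<comment> \<open>Back is Forth with the two interpretations exchanged.\<close>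
  have backward: "\<exists>d'. (d, d') \<in> rname I r \<and> (d', e') \<in> concept_equiv I J"
    if "(d, e) \<in> concept_equiv I J" "(e, e') \<in> rname J r" for d e r e'
    using concept_equiv_forth[OF ints(2) assms(1), of e d e' r] that
    by (simp add: concept_equiv_commute[of _ _ J])
  show ?thesis
    unfolding bisimulation_def
    by (intro conjI allI impI; (elim conjE)?)
      (simp_all only: sub atom concept_equiv_forth[OF ints(1) assms(2)] backward)
qed

text \<open>Bisimilar elements satisfy the same concepts, and for finite interpretations concept
  equivalence is itself a bisimulation.\<close>

lemma max_bisimulation_eq_concept_equiv:
  assumes "finite_interpretation I" and "finite_interpretation J"
  shows "max_bisimulation I J = concept_equiv I J"
proof
  show "max_bisimulation I J \<subseteq> concept_equiv I J"
  proof (clarsimp simp: max_bisimulation_def)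
    fix d e Z
    assume Z: "bisimulation I J Z" "(d, e) \<in> Z"
    then have "d \<in> domain I" "e \<in> domain J"
      by (auto simp: bisimulation_def)
    then show "(d, e) \<in> concept_equiv I J"
      using bisimulation_ext_iff[OF Z] by (auto simp: concept_equiv_def)
  qed
  show "concept_equiv I J \<subseteq> max_bisimulation I J"
    using bisimulation_concept_equiv[OF assms] by (auto simp: max_bisimulation_def)
qed

lemma NamedInd_iff: "d \<in> NamedInd D I \<longleftrightarrow> d \<in> D \<and> (\<exists>C. ext I C = {d})"
proof
  assume "d \<in> NamedInd D I"
  then obtain C where "d \<in> D" and "C \<in> Names D I" and "d \<in> ext I C"
    by (auto simp: NamedInd_def)
  then have "ext I C = {d}"
    by (auto simp: Names_def)
  with \<open>d \<in> D\<close> show "d \<in> D \<and> (\<exists>C. ext I C = {d})"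
    by (intro conjI exI)
qed (auto simp: NamedInd_def Names_def)

lemma concept_equiv_left_total_if_Names_eq:
  assumes "interpretation_alc I" and "finite_interpretation J"
    and "Names D' I = Names D'' J" and "Names D' I \<noteq> {}"
  shows "left_total_on (domain I) (concept_equiv I J)"
  unfolding left_total_on_def
proof (intro ballI, rule ccontr)
  fix d
  assume d: "d \<in> domain I" and "\<nexists>e. (d, e) \<in> concept_equiv I J"
  moreover have intJ: "interpretation_alc J" "finite (domain J)"
    using assms(2) by (auto simp: finite_interpretation_def)
  ultimately obtain C where C: "d \<in> ext I C" "domain J \<inter> ext J C = {}"
    using separating_concept[of "domain J" d I J] by auto
  then have CJ: "ext J C = {}"
    using ext_subset_domain[OF intJ(1), of C] by blast
  obtain N where N: "N \<in> Names D' I" "N \<in> Names D'' J"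
    using assms(3,4) by auto
  then obtain a b where ab: "ext I N = {a}" "ext J N = {b}" "b \<in> D''"
    by (auto simp: Names_def)
  have "b \<in> domain J" "a \<in> domain I"
    using ext_subset_domain[OF intJ(1), of N] ext_subset_domain[OF assms(1), of N] ab by auto
  \<comment> \<open>The second concept is the De Morgan form of the disjunction of \<open>N\<close>
    and \<open>C\<close>. Since \<open>C\<close> is empty in \<open>J\<close>, both concepts still
    denote exactly \<open>b\<close>.\<close>
  then have "And N (Neg C) \<in> Names D'' J" "Neg (And (Neg N) (Neg C)) \<in> Names D'' J"
    using ab CJ by (auto simp: Names_def)
  then have "And N (Neg C) \<in> Names D' I" "Neg (And (Neg N) (Neg C)) \<in> Names D' I"
    using assms(3) by auto
  then obtain x y where "ext I (And N (Neg C)) = {x}" "ext I (Neg (And (Neg N) (Neg C))) = {y}"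
    by (auto simp only: Names_def mem_Collect_eq)
  \<comment> \<open>The conjunction can only denote \<open>a\<close>, so \<open>a\<close> avoids
    \<open>C\<close>; the disjunction contains both \<open>a\<close> and \<open>d\<close>, so its
    being a singleton forces \<open>a = d\<close>.\<close>
  then have "a \<notin> ext I C" and "a = y" and "d = y"
    using ab(1) C(1) d \<open>a \<in> domain I\<close> by auto
  then show False
    using C(1) by simp
qed

text \<open>The partner of \<open>d\<close> is the element \<open>e\<close> that a name
  \<open>C\<close> of \<open>d\<close> denotes in \<open>J\<close>. If \<open>F\<close> holds at
  \<open>d\<close>, then \<open>And F C\<close> is again a name of \<open>d\<close>, hence a name in
  \<open>J\<close>, and it can only denote \<open>e\<close>.\<close>

lemma NamedInd_concept_equiv_if_Names_eq:
  assumes "interpretation_alc I" and "interpretation_alc J"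
    and "Names D' I = Names D'' J" and "d \<in> NamedInd D' I"
  shows "\<exists>e\<in>NamedInd D'' J. (d, e) \<in> concept_equiv I J"
proof -
  obtain C where C: "d \<in> D'" "ext I C = {d}"
    using assms(4) by (auto simp: NamedInd_iff)
  then have "C \<in> Names D'' J"
    unfolding assms(3)[symmetric] by (auto simp: Names_def)
  then obtain e where e: "e \<in> D''" "ext J C = {e}"
    by (auto simp: Names_def)
  have dom: "d \<in> domain I" "e \<in> domain J"
    using ext_subset_domain[OF assms(1), of C] ext_subset_domain[OF assms(2), of C] C e by auto
  have pres: "e \<in> ext J F" if "d \<in> ext I F" for F
  proof -
    have "And F C \<in> Names D' I"
      using that C by (auto simp: Names_def)
    then have "And F C \<in> Names D'' J"
      using assms(3) by simp
    then show ?thesis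
      using e by (auto simp: Names_def)
  qed
  have "d \<in> ext I F \<longleftrightarrow> e \<in> ext J F" for F
    \<comment> \<open>Preservation of \<open>Neg F\<close> supplies the reflection of
      \<open>F\<close>.\<close>
    using pres[of F] pres[of "Neg F"] dom by auto
  then have "(d, e) \<in> concept_equiv I J"
    using dom by (simp add: concept_equiv_def)
  moreover have "e \<in> NamedInd D'' J"
    using e by (auto simp only: NamedInd_iff)
  ultimately show ?thesis
    by blast
qed

text \<open>Totality on named individuals gives \<open>d\<close> a named partner \<open>e\<close>,
  at which \<open>C\<close> holds. Right-totality on the whole domain excludes every other element
  from \<open>C\<close>, named or not.\<close>

lemma Names_subset_if_concept_equiv_total:
  assumes "interpretation_alc J"
    and "right_total_on (domain J) (concept_equiv I J)"
    and "left_total_on (NamedInd D' I) (concept_equiv I J \<inter> (NamedInd D' I \<times> NamedInd D'' J))"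
  shows "Names D' I \<subseteq> Names D'' J"
proof
  fix C
  assume "C \<in> Names D' I"
  then obtain d where d: "d \<in> D'" "ext I C = {d}"
    by (auto simp: Names_def)
  then have "d \<in> NamedInd D' I"
    by (auto simp: NamedInd_iff)
  then obtain e where e: "(d, e) \<in> concept_equiv I J" "e \<in> NamedInd D'' J"
    using assms(3) by (auto simp: left_total_on_def)
  then obtain N where N: "e \<in> D''" "ext J N = {e}"
    by (auto simp: NamedInd_iff)
  have "e2 = e" if "e2 \<in> ext J C" for e2
  proof -
    have "e2 \<in> domain J"
      using that ext_subset_domain[OF assms(1)] by blast
    then obtain d2 where "(d2, e2) \<in> concept_equiv I J"
      using assms(2) by (auto simp: right_total_on_def)
    \<comment> \<open>As \<open>C\<close> denotes only \<open>d\<close> in \<open>I\<close>, both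
      \<open>e2\<close> and \<open>e\<close> are equivalent to \<open>d\<close>, and the name
      \<open>N\<close> of \<open>e\<close> passes to \<open>e2\<close>.\<close>
    moreover from this have "d2 = d"
      using that d(2) by (auto simp: concept_equiv_def)
    ultimately have "e2 \<in> ext J N"
      using e(1) N(2) by (auto simp: concept_equiv_def)
    then show ?thesis
      using N(2) by simp
  qed
  moreover have "e \<in> ext J C"
    using e(1) d(2) by (auto simp: concept_equiv_def)
  ultimately have "ext J C = {e}"
    by blast
  then show "C \<in> Names D'' J"
    using N(1) by (auto simp: Names_def)
qed

theorem theorem4:
  fixes I :: "('d, 'c, 'r) interp" and J :: "('e, 'c, 'r) interp"
    and D' :: "'d set" and D'' :: "'e set" and Z :: "('d \<times> 'e) set"
  assumes "finite_interpretation I" and "finite_interpretation J"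
    and "D' \<subseteq> domain I" and "D'' \<subseteq> domain J"
    and "Names D' I \<noteq> {}" and "Names D'' J \<noteq> {}"
    and "Z = max_bisimulation I J"
  shows "Names D' I = Names D'' J \<longleftrightarrow>
    (left_total_on (domain I) Z \<and> right_total_on (domain J) Z \<and>
     left_total_on (NamedInd D' I) (Z \<inter> (NamedInd D' I \<times> NamedInd D'' J)) \<and>
     right_total_on (NamedInd D'' J) (Z \<inter> (NamedInd D' I \<times> NamedInd D'' J)))"
    (is "_ \<longleftrightarrow> ?total")
proof
  have Z: "Z = concept_equiv I J"
    using assms(1,2,7) max_bisimulation_eq_concept_equiv by metis
  have ints: "interpretation_alc I" "interpretation_alc J"
    using assms(1,2) by (auto simp: finite_interpretation_def)
  {
    assume eq: "Names D' I = Names D'' J"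
    have "left_total_on (domain I) Z"
      using concept_equiv_left_total_if_Names_eq[OF ints(1) assms(2) eq assms(5)] Z by simp
    moreover have "right_total_on (domain J) Z"
      using concept_equiv_left_total_if_Names_eq[OF ints(2) assms(1) eq[symmetric] assms(6)]
      unfolding Z left_total_on_def right_total_on_def concept_equiv_commute[of _ _ J I] .
    moreover have "left_total_on (NamedInd D' I) (Z \<inter> (NamedInd D' I \<times> NamedInd D'' J))"
      using NamedInd_concept_equiv_if_Names_eq[OF ints eq]
      unfolding Z left_total_on_def by blast
    moreover have "right_total_on (NamedInd D'' J) (Z \<inter> (NamedInd D' I \<times> NamedInd D'' J))"
      using NamedInd_concept_equiv_if_Names_eq[OF ints(2,1) eq[symmetric]]
      unfolding Z right_total_on_def concept_equiv_commute[of _ _ J I] by blast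
    ultimately show ?total
      by simp
  next
    assume tot: ?total
    have "Names D' I \<subseteq> Names D'' J"
      using Names_subset_if_concept_equiv_total ints(2) tot Z by metis
    \<comment> \<open>Exchanging \<open>I\<close> and \<open>J\<close> turns left-totality into
      right-totality, so the same lemma yields the reverse inclusion.\<close>
    moreover have "right_total_on (domain I) (concept_equiv J I)"
      "left_total_on (NamedInd D'' J) (concept_equiv J I \<inter> (NamedInd D'' J \<times> NamedInd D' I))"
      using tot
      unfolding Z left_total_on_def right_total_on_def Int_iff concept_equiv_commute[of _ _ J I]
      by blast+
    then have "Names D'' J \<subseteq> Names D' I"
      using Names_subset_if_concept_equiv_total ints(1) by metis
    ultimately show "Names D' I = Names D'' J"
      by simp
  }
qed

end
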